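(* Let $\mathcal{Z}=\{z_0,\dots,z_{15}\}$ be the set of 16 Wang tiles described in the context, and let $\Omega_\mathcal{Z}$ be its Wang shift. There exist a valid configuration $x\in\Omega_\mathcal{Z}$ and a deterministic finite automaton with output $\mathcal{A}$, with input alphabet $\Sigma^2=\left\{\left(\begin{smallmatrix}0\\0\end{smallmatrix}\right),\left(\begin{smallmatrix}0\\1\end{smallmatrix}\right),\left(\begin{smallmatrix}1\\0\end{smallmatrix}\right),\left(\begin{smallmatrix}1\\1\end{smallmatrix}\right)\right\}$ and outputs in $\{0,\dots,15\}$, such that for every ${\boldsymbol{n}}\in\mathbb{Z}^2$ the tile index at position ${\boldsymbol{n}}$ in $x$ is $x_{\boldsymbol{n}}=\mathcal{A}(\operatorname{rep}_\mathcal{F}({\boldsymbol{n}}))$, where $\operatorname{rep}_\mathcal{F}:\mathbb{Z}^2\to(\Sigma^2)^*$ is the Fibonacci representation function defined in the context.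
   Context: A Wang tile is a 4-tuple $(a,b,c,d)$ of colors, read as (east, north, west, south) edge labels of a unit square. The tiles are $z_0=(D,O,J,O)$, $z_1=(D,O,H,L)$, $z_2=(J,M,D,P)$, $z_3=(D,M,D,K)$, $z_4=(H,P,J,P)$, $z_5=(H,P,H,N)$, $z_6=(H,K,D,P)$, $z_7=(B,O,I,O)$, $z_8=(I,L,E,O)$, $z_9=(I,L,C,L)$, $z_{10}=(A,L,I,O)$, $z_{11}=(E,P,I,P)$, $z_{12}=(I,P,I,K)$, $z_{13}=(I,K,B,M)$, $z_{14}=(I,K,A,K)$, $z_{15}=(C,N,I,P)$ (colors are the letters $A,\dots,P$ as written). A valid configuration is a map $f:\mathbb{Z}^2\to\{0,\dots,15\}$ such that for every ${\boldsymbol{n}}\in\mathbb{Z}^2$ the east label of $z_{f({\boldsymbol{n}})}$ equals the west label of $z_{f({\boldsymbol{n}}+e_1)}$ and the north label of $z_{f({\boldsymbol{n}})}$ equals the south label of $z_{f({\boldsymbol{n}}+e_2)}$; $\Omega_\mathcal{Z}$ is the set of valid configurations. Fibonacci numbers: $F_0=1$, $F_1=1$, $F_{n+2}=F_{n+1}+F_n$ for $n\ge 0$. Let $\Sigma=\{0,1\}$. For an odd-length binary word $w=w_{2k+1}w_{2k}\cdots w_1$ (digits indexed from right to left), $\operatorname{val}_\mathcal{F}(w)=\sum_{i=1}^{2k}w_iF_i-w_{2k+1}F_{2k}$. For $n\in\mathbb{Z}$, $\operatorname{rep}_\mathcal{F}(n)$ is the unique odd-length word $w\in\Sigma(\Sigma\Sigma)^*$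 that contains no factor $11$, does not begin with $000$ and does not begin with $101$, and satisfies $\operatorname{val}_\mathcal{F}(w)=n$ (such a word exists and is unique). For ${\boldsymbol{n}}=(n_1,n_2)\in\mathbb{Z}^2$ let $t=\max\{|\operatorname{rep}_\mathcal{F}(n_1)|,|\operatorname{rep}_\mathcal{F}(n_2)|\}$ and for an odd-length word $w$ with $|w|\le t$ put $\operatorname{pad}_t(w)=(00)^{(t-|w|)/2}w$ if $w$ begins with $0$ and $\operatorname{pad}_t(w)=(10)^{(t-|w|)/2}w$ if $w$ begins with $1$. Then $\operatorname{rep}_\mathcal{F}({\boldsymbol{n}})$ is the word of length $t$ over the alphabet $\Sigma^2$ of column vectors whose top row is $\operatorname{pad}_t(\operatorname{rep}_\mathcal{F}(n_1))$ and whose bottom row is $\operatorname{pad}_t(\operatorname{rep}_\mathcal{F}(n_2))$. A deterministic finite automaton with output (DFAO) is a tuple $(Q,\Sigma',\delta,q_0,\tau)$ with a finite state set $Q$, input alphabet $\Sigma'$, (partial) transition function $\delta:Q\times\Sigma'\to Q$, initial state $q_0$ and output map $\tau$ on states; for a word $w$, $\mathcal{A}(w)=\tau(\delta(q_0,w))$, the output of the state reached from $q_0$ along the path labeled $w$ (which is required to exist). *)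

theory Defs
  imports "HOL-Library.Sublist" "HOL-Number_Theory.Fib"
begin

datatype color =
    Col_A | Col_B | Col_C | Col_D | Col_E | Col_F | Col_G | Col_H
  | Col_I | Col_J | Col_K | Col_L | Col_M | Col_N | Col_O | Col_P

datatype wang_tile =
  Tile (east: color) (north: color) (west: color) (south: color)

definition wang_shift :: "wang_tile list \<Rightarrow> (int \<times> int \<Rightarrow> nat) set" where
  "wang_shift T = {f.
     (\<forall>n. f n < length T) \<and>
     (\<forall>n1 n2. east (T ! f (n1, n2)) = west (T ! f (n1 + 1, n2)) \<and>
              north (T ! f (n1, n2)) = south (T ! f (n1, n2 + 1)))}"

definition tiles_Z :: "wang_tile list" where
  "tiles_Z =
    [Tile Col_D Col_O Col_J Col_O,
     Tile Col_D Col_O Col_H Col_L,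
     Tile Col_J Col_M Col_D Col_P,
     Tile Col_D Col_M Col_D Col_K,
     Tile Col_H Col_P Col_J Col_P,
     Tile Col_H Col_P Col_H Col_N,
     Tile Col_H Col_K Col_D Col_P,
     Tile Col_B Col_O Col_I Col_O,
     Tile Col_I Col_L Col_E Col_O,
     Tile Col_I Col_L Col_C Col_L,
     Tile Col_A Col_L Col_I Col_O,
     Tile Col_E Col_P Col_I Col_P,
     Tile Col_I Col_P Col_I Col_K,
     Tile Col_I Col_K Col_B Col_M,
     Tile Col_I Col_K Col_A Col_K,
     Tile Col_C Col_N Col_I Col_P]"

text \<open>The library's \<open>fib\<close> has \<open>fib 0 = 0\<close> and \<open>fib 1 = 1\<close>; here the
  sequence starts with \<open>fibF 0 = fibF 1 = 1\<close>.\<close>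

definition fibF :: "nat \<Rightarrow> nat" where
  "fibF n = fib (Suc n)"

lemma fibF_0: "fibF 0 = 1" and fibF_1: "fibF 1 = 1" and fibF_rec: "fibF (n + 2) = fibF (n + 1) + fibF n"
  by (simp_all add: fibF_def)

text \<open>A word is the list of its digits from left to right, whereas the digit
  \<open>w\<^sub>i\<close> is indexed from the right, starting at 1. The value is only
  meaningful for words of odd length \<open>2 * k + 1\<close>.\<close>

definition digit :: "nat list \<Rightarrow> nat \<Rightarrow> nat" where
  "digit w i = w ! (length w - i)"

definition val_F :: "nat list \<Rightarrow> int" where
  "val_F w = (let k = (length w - 1) div 2 in
     (\<Sum>i = 1..2 * k. int (digit w i) * int (fibF i))
       - int (digit w (2 * k + 1)) * int (fibF (2 * k)))"

definition canonical :: "nat list \<Rightarrow> bool" where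
  "canonical w \<longleftrightarrow>
     set w \<subseteq> {0, 1} \<and> odd (length w) \<and> \<not> sublist [1, 1] w \<and>
     \<not> prefix [0, 0, 0] w \<and> \<not> prefix [1, 0, 1] w"

text \<open>Every integer is the value of exactly one canonical word.\<close>

definition rep_F :: "int \<Rightarrow> nat list" where
  "rep_F n = (THE w. canonical w \<and> val_F w = n)"

text \<open>Prepending \<open>00\<close> to a word that begins with \<open>0\<close>, or \<open>10\<close> to one that
  begins with \<open>1\<close>, does not change the value.\<close>

definition pad :: "nat \<Rightarrow> nat list \<Rightarrow> nat list" where
  "pad t w = concat (replicate ((t - length w) div 2) (if hd w = 0 then [0, 0] else [1, 0])) @ w"

definition rep_F2 :: "int \<times> int \<Rightarrow> (nat \<times> nat) list" where
  "rep_F2 n = (let u = rep_F (fst n); v = rep_F (snd n); t = max (length u) (length v)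
     in zip (pad t u) (pad t v))"

record ('q, 'a, 'o) dfao =
  states :: "'q set"
  alphabet :: "'a set"
  trans :: "'q \<Rightarrow> 'a \<Rightarrow> 'q option"
  start :: 'q
  out :: "'q \<Rightarrow> 'o"

text \<open>The transition map is a partial function from \<open>states \<times> alphabet\<close> to
  \<open>states\<close>; \<open>None\<close> means undefined. Since finite
  state sets embed into the naturals, automata with states of type \<open>nat\<close> are
  fully general.\<close>

definition is_dfao :: "('q, 'a, 'o) dfao \<Rightarrow> bool" where
  "is_dfao M \<longleftrightarrow>
     finite (states M) \<and> finite (alphabet M) \<and> start M \<in> states M \<and>
     (\<forall>q a q'. trans M q a = Some q' \<longrightarrow>
        q \<in> states M \<and> a \<in> alphabet M \<and> q' \<in> states M)"

fun run :: "('q, 'a, 'o) dfao \<Rightarrow> 'q \<Rightarrow> 'a list \<Rightarrow> 'q option" where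
  "run M q [] = Some q"
| "run M q (a # w) = Option.bind (trans M q a) (\<lambda>q'. run M q' w)"

definition dfao_output :: "('q, 'a, 'o) dfao \<Rightarrow> 'a list \<Rightarrow> 'o option" where
  "dfao_output M w = map_option (out M) (run M (start M) w)"

end

theory Submission
  imports Defs
begin

text \<open>The configuration is fixed by the square of a two-dimensional substitution on the 16 tiles, in
  which a tile is replaced by a block of shape \<open>1 \<times> 1\<close>, \<open>1 \<times> 2\<close>, \<open>2 \<times> 1\<close> or \<open>2 \<times> 2\<close>. Reading a
  pair of digits means passing from a tile to one of the tiles of its image, so that the tiles
  themselves serve as states of the automaton. Words of a fixed length that represent \<open>n\<close> and
  \<open>n + 1\<close> agree up to a first difference \<open>0, 1\<close>, after which they continue as \<open>1010\<dots>\<close> and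
  \<open>0000\<dots>\<close>; for \<open>n = - 1\<close> they are \<open>10101\<dots>\<close> and \<open>00000\<dots>\<close>. Hence the pairs of states reached by two
  neighbouring positions stay in a small finite set, on which the colors are checked to match.\<close>

section \<open>Fibonacci words\<close>

lemma fibF_Suc_Suc: "fibF (Suc (Suc n)) = fibF (Suc n) + fibF n"
  using fibF_rec[of n] by simp

lemma fibF_Suc_0 [simp]: "fibF (Suc 0) = 1"
  using fibF_1 by simp

lemma fibF_pos: "0 < fibF n"
  by (simp add: fibF_def fib_neq_0_nat)

lemma fibF_mono: "m \<le> n \<Longrightarrow> fibF m \<le> fibF n"
  by (simp add: fibF_def fib_mono)

lemma fibF_ge: "n \<le> fibF n"
proof (induction n rule: fib.induct)
  case (3 n)
  then show ?case using fibF_pos[of n] by (simp add: fibF_Suc_Suc)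
qed (simp_all add: fibF_0)

section \<open>Greedy expansions of prescribed length\<close>

fun zeck :: "nat \<Rightarrow> nat \<Rightarrow> nat list" where
  "zeck 0 n = []"
| "zeck (Suc L) n =
    (if n < fibF (Suc L) then 0 # zeck L n else 1 # zeck L (n - fibF (Suc L)))"

text \<open>The argument \<open>a\<close> is the digit to the left of the word.\<close>

fun no_11_after :: "nat \<Rightarrow> nat list \<Rightarrow> bool" where
  "no_11_after a [] = True"
| "no_11_after a (d # w) = (d \<in> {0, 1} \<and> \<not> (a = 1 \<and> d = 1) \<and> no_11_after d w)"

fun word_value :: "nat list \<Rightarrow> nat" where
  "word_value [] = 0"
| "word_value (d # w) = d * fibF (Suc (length w)) + word_value w"

lemma length_zeck [simp]: "length (zeck L n) = L"
  by (induction L arbitrary: n) auto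

text \<open>Removing \<open>fibF (Suc L)\<close> from a number below
  \<open>fibF (Suc (Suc L))\<close> leaves less than \<open>fibF L\<close>, so the greedy choice of
  a 1 is always followed by a 0.\<close>

lemma no_11_after_zeck:
  "n < fibF (Suc L) \<Longrightarrow> a = 0 \<or> n < fibF L \<Longrightarrow> no_11_after a (zeck L n)"
proof (induction L arbitrary: a n)
  case (Suc L)
  then show ?case using Suc.IH[of "n - fibF (Suc L)" 1] fibF_mono[of L "Suc L"]
    by (auto simp: fibF_Suc_Suc)
qed simp

lemma word_value_zeck: "n < fibF (Suc L) \<Longrightarrow> word_value (zeck L n) = n"
proof (induction L arbitrary: n)
  case (Suc L)
  then show ?case using fibF_mono[of L "Suc L"] by (auto simp: fibF_Suc_Suc)
qed simp

lemma word_value_less: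
  "no_11_after a w \<Longrightarrow> word_value w < fibF (Suc (length w)) \<and> (a = 1 \<longrightarrow> word_value w < fibF (length w))"
proof (induction w arbitrary: a)
  case (Cons d w)
  then show ?case by (fastforce simp: fibF_Suc_Suc)
qed (simp add: fibF_0)

text \<open>This is uniqueness: by \<open>word_value_less\<close> the tail stays below the leading
  weight, so the greedy test recovers the leading digit.\<close>

lemma zeck_word_value: "no_11_after a w \<Longrightarrow> zeck (length w) (word_value w) = w"
proof (induction w arbitrary: a)
  case (Cons d w)
  then show ?case using word_value_less[of d w] by auto
qed simp

lemma zeck_0: "zeck L 0 = replicate L 0"
  by (induction L) (auto simp: fibF_pos)

fun alternating :: "nat \<Rightarrow> nat \<Rightarrow> nat list" where
  "alternating d 0 = []"
| "alternating d (Suc L) = d # alternating (1 - d) L"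

text \<open>These are the words just before a carry. Removing the leading digit turns either extreme
  value into the other, hence the joint induction.\<close>

lemma zeck_max:
  "zeck L (fibF (Suc L) - 1) = alternating 1 L" "zeck L (fibF L - 1) = alternating 0 L"
proof (induction L)
  case (Suc L)
  case 1
  have "fibF (Suc (Suc L)) - 1 - fibF (Suc L) = fibF L - 1" "\<not> fibF (Suc (Suc L)) - 1 < fibF (Suc L)"
    using fibF_pos[of L] fibF_pos[of "Suc L"] by (auto simp: fibF_Suc_Suc)
  with Suc(2) show ?case by (simp del: One_nat_def)
next
  case (Suc L)
  case 2
  show ?case using Suc(1) fibF_pos[of "Suc L"] by simp
qed simp_all

section \<open>Words for integers of both signs\<close>

definition signed_word :: "nat \<Rightarrow> int \<Rightarrow> nat list" where
  "signed_word L n = (if 0 \<le> n then 0 # zeck L (nat n) else 1 # zeck L (nat (n + int (fibF L))))"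

text \<open>A leading 0 leaves a remainder below \<open>fibF (Suc L)\<close>. A leading 1 of weight
  \<open>- fibF L\<close> must be followed by a 0, which leaves a remainder below
  \<open>fibF L\<close>.\<close>

definition in_range :: "nat \<Rightarrow> int \<Rightarrow> bool" where
  "in_range L n \<longleftrightarrow> - int (fibF L) \<le> n \<and> n < int (fibF (Suc L))"

lemma in_range_mono: "in_range L n \<Longrightarrow> L \<le> M \<Longrightarrow> in_range M n"
  using fibF_mono[of L M] fibF_mono[of "Suc L" "Suc M"] by (simp add: in_range_def)

lemma ex_in_range: "\<exists>k. in_range (2 * k) n"
proof -
  \<comment> \<open>The crude bound \<open>fibF m\<close> \<ge> \<open>m\<close> shows that k = |n|
    is large enough.\<close>
  have "in_range (2 * nat \<bar>n\<bar>) n"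
    using fibF_ge[of "2 * nat \<bar>n\<bar>"] fibF_ge[of "Suc (2 * nat \<bar>n\<bar>)"]
    unfolding in_range_def by linarith
  then show ?thesis ..
qed

lemma length_signed_word [simp]: "length (signed_word L n) = Suc L"
  by (simp add: signed_word_def)

lemma no_11_after_signed_word: "in_range L n \<Longrightarrow> no_11_after 0 (signed_word L n)"
  by (auto simp: signed_word_def in_range_def fibF_pos intro!: no_11_after_zeck
      intro: less_le_trans[OF _ fibF_mono[of L "Suc L"]])

text \<open>For negative n the identity - \<open>fibF (L + 2)\<close> + \<open>fibF (L + 1)\<close>
  = - \<open>fibF L\<close> replaces the leading 1 by 101; for the other n only zeros are
  added.\<close>

lemma signed_word_Suc_Suc:
  assumes "in_range L n"
  shows "signed_word (Suc (Suc L)) n = (if 0 \<le> n then [0, 0] else [1, 0]) @ signed_word L n"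
proof (cases "0 \<le> n")
  case True
  then have "nat n < fibF (Suc L)" using assms by (simp add: in_range_def nat_less_iff)
  then show ?thesis using True fibF_mono[of "Suc L" "Suc (Suc L)"] by (simp add: signed_word_def)
next
  case False
  then have "nat (n + int (fibF (Suc (Suc L)))) < fibF (Suc (Suc L))"
    "\<not> nat (n + int (fibF (Suc (Suc L)))) < fibF (Suc L)"
    "nat (n + int (fibF (Suc (Suc L)))) - fibF (Suc L) = nat (n + int (fibF L))"
    using assms by (auto simp: in_range_def fibF_Suc_Suc)
  then show ?thesis using False by (simp add: signed_word_def)
qed

section \<open>The Fibonacci representation\<close>

lemma no_11_after_iff:
  "d \<in> {0, 1} \<and> no_11_after d w \<longleftrightarrow> set (d # w) \<subseteq> {0, 1} \<and> \<not> sublist [1, 1] (d # w)"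
proof (induction w arbitrary: d)
  case (Cons e w)
  have "sublist [1, 1] (d # e # w) \<longleftrightarrow> d = 1 \<and> e = 1 \<or> sublist [1, 1] (e # w)"
    by (auto simp: sublist_Cons_right)
  then show ?case using Cons[of e] by auto
qed (auto simp: sublist_Cons_right)

lemma val_F_Cons:
  assumes "even (length w)"
  shows "val_F (d # w) = int (word_value w) - int d * int (fibF (length w))"
proof -
  have sum: "(\<Sum>i = 1..length w. int (digit w i) * int (fibF i)) = int (word_value w)" for w
  proof (induction w)
    case (Cons e w)
    \<comment> \<open>Digits are indexed from the right, so a digit added in front shifts no
      index.\<close>
    have "digit (e # w) i = digit w i" if "i \<in> {1..length w}" for i
      using that by (simp add: digit_def Suc_diff_le)
    then have "(\<Sum>i = 1..length w. int (digit (e # w) i) * int (fibF i)) = int (word_value w)"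
      using Cons by simp
    then show ?case by (simp add: digit_def)
  qed simp
  have "digit (d # w) i = digit w i" if "i \<in> {1..length w}" for i
    using that by (simp add: digit_def Suc_diff_le)
  then have "(\<Sum>i = 1..length w. int (digit (d # w) i) * int (fibF i)) = int (word_value w)"
    using sum[of w] by simp
  then show ?thesis using assms by (simp add: val_F_def digit_def)
qed

lemma val_F_signed_word:
  assumes "even L" "in_range L n"
  shows "val_F (signed_word L n) = n"
  using assms word_value_zeck[of "nat n" L] word_value_zeck[of "nat (n + int (fibF L))" L]
    fibF_mono[of L "Suc L"]
  by (auto simp: signed_word_def val_F_Cons in_range_def nat_less_iff)

text \<open>The forbidden prefixes 000 and 101 are exactly the traces of one padding step.\<close>

lemma canonical_signed_word_iff:
  assumes "in_range (2 * k) n"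
  shows "canonical (signed_word (2 * k) n) \<longleftrightarrow> k = 0 \<or> \<not> in_range (2 * (k - 1)) n"
proof -
  let ?w = "signed_word (2 * k) n"
  have "set ?w \<subseteq> {0, 1} \<and> \<not> sublist [1, 1] ?w"
    using no_11_after_signed_word[OF assms] no_11_after_iff[of "hd ?w" "tl ?w"]
    by (cases ?w) auto
  then have can: "canonical ?w \<longleftrightarrow> \<not> prefix [0, 0, 0] ?w \<and> \<not> prefix [1, 0, 1] ?w"
    by (auto simp: canonical_def)
  show ?thesis
  proof (cases k)
    case 0
    then show ?thesis using can by (auto simp: signed_word_def)
  next
    case (Suc j)
    have "prefix [0, 0, 0] ?w \<or> prefix [1, 0, 1] ?w" if "in_range (2 * j) n"
      using that Suc by (simp add: signed_word_Suc_Suc) (simp add: signed_word_def)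
    \<comment> \<open>The greedy tests give n < \<open>fibF (2 * j + 1)\<close> for the prefix 000
      and n \<ge> - \<open>fibF (2 * j)\<close> for 101.\<close>
    moreover have "in_range (2 * j) n" if "prefix [0, 0, 0] ?w \<or> prefix [1, 0, 1] ?w"
      using that assms Suc
      by (auto simp: signed_word_def in_range_def fibF_Suc_Suc split: if_splits)
    ultimately show ?thesis using can Suc by auto
  qed
qed

lemma canonical_eq_signed_word:
  assumes "canonical w"
  obtains k where "length w = Suc (2 * k)" "in_range (2 * k) (val_F w)"
    "w = signed_word (2 * k) (val_F w)"
proof -
  obtain k where k: "length w = Suc (2 * k)"
    using assms by (auto simp: canonical_def elim: oddE)
  then obtain d r where w: "w = d # r" by (cases w) auto
  then have len: "length r = 2 * k" and r: "d \<in> {0, 1}" "no_11_after d r"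
    using k assms no_11_after_iff[of d r] by (auto simp: canonical_def)
  have val: "val_F w = int (word_value r) - int d * int (fibF (2 * k))"
    using val_F_Cons[of r d] w len by simp
  have less: "word_value r < fibF (Suc (2 * k))" "d = 1 \<Longrightarrow> word_value r < fibF (2 * k)"
    using word_value_less[OF r(2)] len by auto
  have "zeck (2 * k) (word_value r) = r"
    using zeck_word_value[OF r(2)] len by simp
  then have "w = signed_word (2 * k) (int (word_value r) - int d * int (fibF (2 * k)))"
    using r(1) less w by (cases "d = 0") (simp_all add: signed_word_def)
  then have "w = signed_word (2 * k) (val_F w)" using val by simp
  moreover have "in_range (2 * k) (val_F w)"
    using r(1) less unfolding val in_range_def by (cases "d = 0") simp_all
  ultimately show thesis using k by (intro that)
qed

definition half_length :: "int \<Rightarrow> nat" where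
  "half_length n = (LEAST k. in_range (2 * k) n)"

lemma in_range_iff: "in_range (2 * k) n \<longleftrightarrow> half_length n \<le> k"
  using LeastI_ex[OF ex_in_range[of n]] in_range_mono[of "2 * half_length n" n "2 * k"]
    Least_le[of "\<lambda>k. in_range (2 * k) n" k]
  by (auto simp: half_length_def)

text \<open>Canonical words are signed words, and canonicity forces the least admissible length;
  this yields existence and uniqueness for the definite description.\<close>

lemma rep_F_eq: "rep_F n = signed_word (2 * half_length n) n"
  unfolding rep_F_def
proof (rule the_equality)
  have "half_length n = 0 \<or> \<not> half_length n \<le> half_length n - 1" by auto
  then show "canonical (signed_word (2 * half_length n) n) \<and>
      val_F (signed_word (2 * half_length n) n) = n"
    by (simp add: canonical_signed_word_iff in_range_iff val_F_signed_word)
next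
  fix w assume w: "canonical w \<and> val_F w = n"
  then obtain k where k: "in_range (2 * k) n" "w = signed_word (2 * k) n"
    by (metis canonical_eq_signed_word)
  then have "k = 0 \<or> \<not> in_range (2 * (k - 1)) n"
    using w canonical_signed_word_iff by blast
  then have "k = half_length n" using k(1) by (auto simp: in_range_iff)
  with k show "w = signed_word (2 * half_length n) n" by simp
qed

lemma pad_rep_F:
  assumes "half_length n \<le> k"
  shows "pad (Suc (2 * k)) (rep_F n) = signed_word (2 * k) n"
proof -
  let ?h = "half_length n" and ?p = "if 0 \<le> n then [0, 0] else [1, 0 :: nat]"
  have "concat (replicate j ?p) @ signed_word (2 * ?h) n = signed_word (2 * (?h + j)) n" for j
  proof (induction j)
    case (Suc j)
    have "in_range (2 * (?h + j)) n" unfolding in_range_iff by simp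
    then have "signed_word (2 * (?h + Suc j)) n = ?p @ signed_word (2 * (?h + j)) n"
      using signed_word_Suc_Suc[of "2 * (?h + j)" n] by simp
    then show ?case unfolding Suc[symmetric] by simp
  qed simp
  from this[of "k - ?h"] have "concat (replicate (k - ?h) ?p) @ rep_F n = signed_word (2 * k) n"
    using assms by (simp add: rep_F_eq)
  moreover have "(if hd (rep_F n) = 0 then [0, 0] else [1, 0]) = ?p"
    by (simp add: rep_F_eq signed_word_def)
  moreover have "(Suc (2 * k) - length (rep_F n)) div 2 = k - ?h"
    unfolding rep_F_eq length_signed_word by presburger
  ultimately show ?thesis by (simp only: pad_def)
qed

lemma rep_F2_eq:
  "rep_F2 (n1, n2) = (let k = max (half_length n1) (half_length n2)
     in zip (signed_word (2 * k) n1) (signed_word (2 * k) n2))"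
proof -
  let ?k = "max (half_length n1) (half_length n2)"
  have "max (length (rep_F n1)) (length (rep_F n2)) = Suc (2 * ?k)"
    unfolding rep_F_eq length_signed_word by linarith
  then show ?thesis
    unfolding rep_F2_def Let_def fst_conv snd_conv by (simp only: pad_rep_F max.cobounded1 max.cobounded2)
qed

section \<open>Neighbouring words in a two-dimensional automaton\<close>

fun drive :: "('q \<Rightarrow> nat \<Rightarrow> nat \<Rightarrow> 'q) \<Rightarrow> 'q \<Rightarrow> nat list \<Rightarrow> nat list \<Rightarrow> 'q" where
  "drive st q (a # u) (b # w) = drive st (st q a b) u w"
| "drive st q _ _ = q"

text \<open>Exchanging the coordinates lets one locale serve both the east and the north
  direction.\<close>

lemma drive_swap: "drive (\<lambda>q a b. st q b a) q u w = drive st q w u"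
  by (induction st q w u rule: drive.induct) auto

text \<open>The functions \<open>along\<close> and \<open>across\<close> give the last digits read on the way to a state. The pairs
  in \<open>D\<close> and \<open>E\<close> are the states reached by a word and its successor, according to whether the
  word that comes first ends with \<open>0\<close> or \<open>1\<close>.\<close>

locale fibonacci_neighbours =
  fixes st :: "'q \<Rightarrow> nat \<Rightarrow> nat \<Rightarrow> 'q" and q0 :: 'q and Q :: "'q set"
    and along across :: "'q \<Rightarrow> nat" and D E :: "('q \<times> 'q) set"
  assumes init: "\<lbrakk>a \<in> {0, 1}; b \<in> {0, 1}\<rbrakk> \<Longrightarrow>
      st q0 a b \<in> Q \<and> along (st q0 a b) = a \<and> across (st q0 a b) = b"
    and init_E: "b \<in> {0, 1} \<Longrightarrow> (st q0 1 b, st q0 0 b) \<in> E"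
    and step: "\<lbrakk>q \<in> Q; a \<in> {0, 1}; b \<in> {0, 1}; \<not> (along q = 1 \<and> a = 1); \<not> (across q = 1 \<and> b = 1)\<rbrakk>
      \<Longrightarrow> st q a b \<in> Q \<and> along (st q a b) = a \<and> across (st q a b) = b"
    and split: "\<lbrakk>q \<in> Q; b \<in> {0, 1}; along q \<noteq> 1; \<not> (across q = 1 \<and> b = 1)\<rbrakk>
      \<Longrightarrow> (st q 0 b, st q 1 b) \<in> D"
    and D_step: "\<lbrakk>(q, r) \<in> D; b \<in> {0, 1}; \<not> (across q = 1 \<and> b = 1)\<rbrakk>
      \<Longrightarrow> (st q 1 b, st r 0 b) \<in> E \<and> across (st q 1 b) = b"
    and E_step: "\<lbrakk>(q, r) \<in> E; b \<in> {0, 1}; \<not> (across q = 1 \<and> b = 1)\<rbrakk>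
      \<Longrightarrow> (st q 0 b, st r 0 b) \<in> D \<and> across (st q 0 b) = b"
begin

text \<open>The first word reads 1 and 0 in turn while the second reads zeros, so the pair moves
  between \<open>D\<close> and \<open>E\<close>; both claims need each other in the
  induction.\<close>

lemma drive_max:
  assumes "no_11_after (across q) w" "length w = L"
  shows "(q, r) \<in> D \<Longrightarrow>
      (drive st q (alternating 1 L) w, drive st r (replicate L 0) w) \<in> D \<union> E"
    and "(q, r) \<in> E \<Longrightarrow>
      (drive st q (alternating 0 L) w, drive st r (replicate L 0) w) \<in> D \<union> E"
  using assms
proof (induction w arbitrary: q r L)
  case (Cons b w)
  {
    case 1
    then have "(st q 1 b, st r 0 b) \<in> E" "across (st q 1 b) = b"
      using D_step[of q r b] by auto
    then show ?case using 1 Cons.IH(2)[of "st q 1 b" "st r 0 b" "length w"] by auto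
  next
    case 2
    then have "(st q 0 b, st r 0 b) \<in> D" "across (st q 0 b) = b"
      using E_step[of q r b] by auto
    then show ?case using 2 Cons.IH(1)[of "st q 0 b" "st r 0 b" "length w"] by auto
  }
qed auto

lemma drive_Suc:
  assumes "q \<in> Q" "no_11_after (across q) w" "length w = L"
    and "Suc n < fibF (Suc L)" "along q = 1 \<longrightarrow> Suc n < fibF L"
  shows "(drive st q (zeck L n) w, drive st q (zeck L (Suc n)) w) \<in> D \<union> E"
  using assms
proof (induction w arbitrary: q L n)
  case Nil
  then show ?case by simp
next
  case (Cons b w)
  then obtain M where L: "L = Suc M" "length w = M" by auto
  have b: "b \<in> {0, 1}" "\<not> (across q = 1 \<and> b = 1)" "no_11_after b w"
    using Cons.prems by auto
  \<comment> \<open>Either n and n + 1 share the leading digit 0, or they share 1, or the carry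
    happens here: 0 and a maximal tail against 1 and zeros.\<close>
  consider "Suc n < fibF (Suc M)" | "n \<ge> fibF (Suc M)" | "Suc n = fibF (Suc M)" by linarith
  then show ?case
  proof cases
    case 1
    have "st q 0 b \<in> Q \<and> along (st q 0 b) = 0 \<and> across (st q 0 b) = b"
      using step[of q 0 b] b Cons.prems by auto
    then show ?thesis using 1 Cons.IH[of "st q 0 b" M n] L b by simp
  next
    case 2
    then have "st q 1 b \<in> Q \<and> along (st q 1 b) = 1 \<and> across (st q 1 b) = b"
      using step[of q 1 b] b Cons.prems L by auto
    moreover have "Suc (n - fibF (Suc M)) < fibF M"
      using 2 Cons.prems L by (auto simp: fibF_Suc_Suc)
    ultimately show ?thesis
      using 2 Cons.IH[of "st q 1 b" M "n - fibF (Suc M)"] L b fibF_mono[of M "Suc M"]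
      by (simp add: Suc_diff_le)
  next
    case 3
    then have "(st q 0 b, st q 1 b) \<in> D" "across (st q 0 b) = b"
      using split[of q b] step[of q 0 b] b Cons.prems L by auto
    moreover have "n = fibF (Suc M) - 1" using 3 by simp
    ultimately show ?thesis
      using 3 drive_max(1)[of "st q 0 b" w M "st q 1 b"] L b
      by (simp add: zeck_max(1) zeck_0 del: One_nat_def)
  qed
qed

lemma drive_signed_word_succ:
  assumes "in_range L n" "in_range L (n + 1)" "no_11_after 0 w" "length w = Suc L"
  shows "(drive st q0 (signed_word L n) w, drive st q0 (signed_word L (n + 1)) w) \<in> D \<union> E"
proof -
  obtain b v where w: "w = b # v" "b \<in> {0, 1}" "no_11_after b v" "length v = L"
    using assms(3,4) by (cases w) auto
  \<comment> \<open>The sign digit changes only between -1 and 0, where \<open>init_E\<close>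
    applies; otherwise it is shared and the successor is taken in the remaining word.\<close>
  consider "0 \<le> n" | "n = - 1" | "n < - 1" by linarith
  then show ?thesis
  proof cases
    case 1
    then show ?thesis
      using drive_Suc[of "st q0 0 b" v L "nat n"] init[of 0 b] w assms(2)
      by (simp add: signed_word_def in_range_def nat_add_distrib nat_less_iff)
  next
    case 2
    then have "signed_word L n = 1 # alternating 0 L" "signed_word L (n + 1) = 0 # replicate L 0"
      using zeck_max(2)[of L] fibF_pos[of L] by (auto simp: signed_word_def zeck_0 nat_diff_distrib)
    then show ?thesis
      using drive_max(2)[of "st q0 1 b" v L "st q0 0 b"] init[of 1 b] init_E[of b] w by simp
  next
    case 3
    define m where "m = nat (n + int (fibF L))"
    have "nat (n + 1 + int (fibF L)) = Suc m" "Suc m < fibF L"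
      using 3 assms(1) by (auto simp: m_def in_range_def)
    then show ?thesis
      using 3 drive_Suc[of "st q0 1 b" v L m] init[of 1 b] w fibF_mono[of L "Suc L"]
      by (simp add: signed_word_def m_def)
  qed
qed

end

section \<open>The automaton\<close>

text \<open>The state 16 is the initial one. Row \<open>q\<close> lists the targets for the digit pairs
  \<open>(0, 0), (0, 1), (1, 0), (1, 1)\<close>; for \<open>q < 16\<close> the targets other than the dummies \<open>0\<close> at pairs
  that would produce a factor \<open>11\<close> form the block substituted for tile \<open>q\<close>.\<close>

definition step_table :: "nat list list" where
  "step_table =
    [[14, 0, 0, 0], [13, 0, 0, 0], [12, 0, 10, 0], [11, 0, 8, 0], [14, 0, 7, 0], [13, 0, 7, 0],
     [12, 0, 7, 0], [12, 6, 0, 0], [14, 3, 0, 0], [13, 3, 0, 0], [12, 2, 0, 0], [12, 6, 10, 1],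
     [11, 6, 8, 1], [15, 5, 9, 1], [11, 4, 8, 1], [12, 2, 7, 0], [12, 6, 8, 1]]"

definition tile_step :: "nat \<Rightarrow> nat \<Rightarrow> nat \<Rightarrow> nat" where
  "tile_step q a b = step_table ! q ! (2 * a + b)"

text \<open>The digit is visible in the colors: it is 1 exactly for the tiles whose north and south
  labels lie in {L, O}. Likewise \<open>row_digit\<close> is 1 exactly when east and west lie in {D,
  H, J}.\<close>

definition column_digit :: "nat \<Rightarrow> nat" where
  "column_digit q = (if q \<in> {0, 1, 7, 8, 9, 10} then 1 else 0)"

definition row_digit :: "nat \<Rightarrow> nat" where
  "row_digit q = (if q < 7 then 1 else 0)"

text \<open>The four sets are finite invariants, closed under the locale rules and small enough for
  all colors to match. Both members of an east pair have the same \<open>row_digit\<close>, so it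
  suffices to test the first one.\<close>

definition east_D :: "(nat \<times> nat) set" where
  "east_D = {(2, 0), (2, 4), (3, 6), (4, 1), (5, 1), (6, 1), (6, 5), (11, 8), (12, 7), (12, 10),
    (12, 11), (12, 15), (13, 7), (13, 11), (13, 12), (14, 7), (14, 11), (15, 9)}"

definition east_E :: "(nat \<times> nat) set" where
  "east_E = {(0, 3), (1, 2), (1, 3), (1, 6), (7, 13), (8, 12), (9, 11), (9, 12), (10, 14)}"

definition north_D :: "(nat \<times> nat) set" where
  "north_D = {(7, 0), (7, 8), (7, 10), (8, 1), (8, 9), (9, 1), (10, 1), (10, 9), (11, 4), (11, 6),
    (11, 15), (12, 2), (12, 6), (12, 11), (12, 15), (13, 3), (13, 12), (13, 14), (14, 3), (14, 12),
    (15, 5)}"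

definition north_E :: "(nat \<times> nat) set" where
  "north_E = {(0, 7), (1, 7), (1, 8), (1, 10), (2, 13), (3, 13), (4, 11), (5, 11), (6, 12), (6, 14)}"

section \<open>Finite checks on the tables\<close>

lemma tile_step_init:
  "\<forall>a\<in>{0, 1}. \<forall>b\<in>{0, 1}. tile_step 16 a b \<in> set [0..<16] \<and>
     column_digit (tile_step 16 a b) = a \<and> row_digit (tile_step 16 a b) = b"
  by code_simp

text \<open>The four tiles with both coordinates in {-1, 0} are fixed by the squared substitution.
  Hence a padding step, which turns a leading a into a0a, does not change the state reached.\<close>

lemma tile_step_fixes_init:
  "\<forall>a\<in>{0, 1}. \<forall>b\<in>{0, 1}.
     tile_step (tile_step (tile_step 16 a b) 0 0) a b = tile_step 16 a b"
  by code_simp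

lemma tile_step_in_range:
  "\<forall>q\<in>set [0..<17]. \<forall>a\<in>{0, 1}. \<forall>b\<in>{0, 1}. tile_step q a b \<in> set [0..<16]"
  by code_simp

lemma tile_step_less: "q < 17 \<Longrightarrow> a \<in> {0, 1} \<Longrightarrow> b \<in> {0, 1} \<Longrightarrow> tile_step q a b < 16"
  using bspec[OF tile_step_in_range, of q] by auto

lemma tile_step_digits:
  "\<forall>q\<in>set [0..<16]. \<forall>a\<in>{0, 1}. \<forall>b\<in>{0, 1}.
     \<not> (column_digit q = 1 \<and> a = 1) \<longrightarrow> \<not> (row_digit q = 1 \<and> b = 1) \<longrightarrow>
     tile_step q a b \<in> set [0..<16] \<and>
     column_digit (tile_step q a b) = a \<and> row_digit (tile_step q a b) = b"
  by code_simp

lemma east_init: "\<forall>b\<in>{0, 1}. (tile_step 16 1 b, tile_step 16 0 b) \<in> east_E"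
  by code_simp

lemma east_split:
  "\<forall>q\<in>set [0..<16]. \<forall>b\<in>{0, 1}. column_digit q \<noteq> 1 \<longrightarrow> \<not> (row_digit q = 1 \<and> b = 1) \<longrightarrow>
     (tile_step q 0 b, tile_step q 1 b) \<in> east_D"
  by code_simp

lemma east_D_step:
  "\<forall>(q, r)\<in>east_D. \<forall>b\<in>{0, 1}. \<not> (row_digit q = 1 \<and> b = 1) \<longrightarrow>
     (tile_step q 1 b, tile_step r 0 b) \<in> east_E \<and> row_digit (tile_step q 1 b) = b"
  by code_simp

lemma east_E_step:
  "\<forall>(q, r)\<in>east_E. \<forall>b\<in>{0, 1}. \<not> (row_digit q = 1 \<and> b = 1) \<longrightarrow>
     (tile_step q 0 b, tile_step r 0 b) \<in> east_D \<and> row_digit (tile_step q 0 b) = b"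
  by code_simp

lemma east_match: "\<forall>(q, r)\<in>east_D \<union> east_E. east (tiles_Z ! q) = west (tiles_Z ! r)"
  by code_simp

lemma north_init: "\<forall>a\<in>{0, 1}. (tile_step 16 a 1, tile_step 16 a 0) \<in> north_E"
  by code_simp

lemma north_split:
  "\<forall>q\<in>set [0..<16]. \<forall>a\<in>{0, 1}. row_digit q \<noteq> 1 \<longrightarrow> \<not> (column_digit q = 1 \<and> a = 1) \<longrightarrow>
     (tile_step q a 0, tile_step q a 1) \<in> north_D"
  by code_simp

lemma north_D_step:
  "\<forall>(q, r)\<in>north_D. \<forall>a\<in>{0, 1}. \<not> (column_digit q = 1 \<and> a = 1) \<longrightarrow>
     (tile_step q a 1, tile_step r a 0) \<in> north_E \<and> column_digit (tile_step q a 1) = a"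
  by code_simp

lemma north_E_step:
  "\<forall>(q, r)\<in>north_E. \<forall>a\<in>{0, 1}. \<not> (column_digit q = 1 \<and> a = 1) \<longrightarrow>
     (tile_step q a 0, tile_step r a 0) \<in> north_D \<and> column_digit (tile_step q a 0) = a"
  by code_simp

lemma north_match: "\<forall>(q, r)\<in>north_D \<union> north_E. north (tiles_Z ! q) = south (tiles_Z ! r)"
  by code_simp

interpretation east: fibonacci_neighbours tile_step 16 "set [0..<16]" column_digit row_digit
  east_D east_E
proof (unfold_locales, goal_cases)
  case (1 a b)
  then show ?case using tile_step_init by auto
next
  case (2 b)
  then show ?case using east_init by auto
next
  case (3 q a b)
  then show ?case using bspec[OF tile_step_digits, of q] by auto
next
  case (4 q b)
  then show ?case using bspec[OF east_split, of q] by auto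
next
  case (5 q r b)
  then show ?case using bspec[OF east_D_step, of "(q, r)"] by auto
next
  case (6 q r b)
  then show ?case using bspec[OF east_E_step, of "(q, r)"] by auto
qed

interpretation north: fibonacci_neighbours "\<lambda>q a b. tile_step q b a" 16 "set [0..<16]"
  row_digit column_digit north_D north_E
proof (unfold_locales, goal_cases)
  case (1 a b)
  then show ?case using tile_step_init by auto
next
  case (2 b)
  then show ?case using north_init by auto
next
  case (3 q a b)
  then show ?case using bspec[OF tile_step_digits, of q] by auto
next
  case (4 q b)
  then show ?case using bspec[OF north_split, of q] by auto
next
  case (5 q r b)
  then show ?case using bspec[OF north_D_step, of "(q, r)"] by auto
next
  case (6 q r b)
  then show ?case using bspec[OF north_E_step, of "(q, r)"] by auto
qed

section \<open>The configuration and its validity\<close>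

definition config_at :: "nat \<Rightarrow> int \<times> int \<Rightarrow> nat" where
  "config_at k n = drive tile_step 16 (signed_word (2 * k) (fst n)) (signed_word (2 * k) (snd n))"

definition config :: "int \<times> int \<Rightarrow> nat" where
  "config n = config_at (max (half_length (fst n)) (half_length (snd n))) n"

lemma config_eq:
  assumes "half_length n1 \<le> k" "half_length n2 \<le> k"
  shows "config (n1, n2) = config_at k (n1, n2)"
proof -
  let ?m = "max (half_length n1) (half_length n2)"
  have "config_at (?m + j) (n1, n2) = config_at ?m (n1, n2)" for j
  proof (induction j)
    case (Suc j)
    have ranges: "in_range (2 * (?m + j)) n1" "in_range (2 * (?m + j)) n2"
      unfolding in_range_iff by auto
    obtain a u where a: "a \<in> {0, 1}" "signed_word (2 * (?m + j)) n1 = a # u"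
      "signed_word (Suc (Suc (2 * (?m + j)))) n1 = a # 0 # a # u"
      using signed_word_Suc_Suc[OF ranges(1)] by (cases "0 \<le> n1") (auto simp: signed_word_def)
    obtain b w where b: "b \<in> {0, 1}" "signed_word (2 * (?m + j)) n2 = b # w"
      "signed_word (Suc (Suc (2 * (?m + j)))) n2 = b # 0 # b # w"
      using signed_word_Suc_Suc[OF ranges(2)] by (cases "0 \<le> n2") (auto simp: signed_word_def)
    have "2 * (?m + Suc j) = Suc (Suc (2 * (?m + j)))" by simp
    then have "config_at (?m + Suc j) (n1, n2) =
        drive tile_step (tile_step (tile_step (tile_step 16 a b) 0 0) a b) u w"
      unfolding config_at_def using a(3) b(3) by (simp only: fst_conv snd_conv drive.simps)
    also have "\<dots> = config_at (?m + j) (n1, n2)"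
      unfolding config_at_def fst_conv snd_conv a(2) b(2) drive.simps
      using tile_step_fixes_init a(1) b(1) by metis
    finally have "config_at (?m + Suc j) (n1, n2) = config_at (?m + j) (n1, n2)" .
    with Suc show ?case by simp
  qed simp
  from this[of "k - ?m"] show ?thesis using assms by (simp add: config_def)
qed

lemma drive_tile_step_less:
  "q < 16 \<Longrightarrow> no_11_after a u \<Longrightarrow> no_11_after b w \<Longrightarrow> drive tile_step q u w < 16"
proof (induction u w arbitrary: q a b rule: list_induct2')
  case (4 c u d w)
  then have "tile_step q c d < 16" using tile_step_less[of q c d] by simp
  then show ?case using 4 by auto
qed auto

lemma config_less: "config (n1, n2) < 16"
proof -
  let ?k = "max (half_length n1) (half_length n2)"
  \<comment> \<open>State 16 is not a tile, so the first letter, which leaves it, is read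
    separately.\<close>
  obtain c u d w where uw: "signed_word (2 * ?k) n1 = c # u" "signed_word (2 * ?k) n2 = d # w"
    by (metis length_Suc_conv length_signed_word)
  have "no_11_after 0 (c # u)" "no_11_after 0 (d # w)"
    unfolding uw[symmetric] by (rule no_11_after_signed_word, simp add: in_range_iff)+
  then show ?thesis
    using drive_tile_step_less[of "tile_step 16 c d" c u d w] tile_step_less[of 16 c d] uw
    by (simp add: config_def config_at_def)
qed

lemma config_in_wang_shift: "config \<in> wang_shift tiles_Z"
proof -
  have "east (tiles_Z ! config (n1, n2)) = west (tiles_Z ! config (n1 + 1, n2))" for n1 n2
  proof -
    \<comment> \<open>A common length for all coordinates involved lets the words be compared digit
      by digit.\<close>
    define k where "k = max (half_length n1) (max (half_length (n1 + 1)) (half_length n2))"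
    have k: "half_length n1 \<le> k" "half_length (n1 + 1) \<le> k" "half_length n2 \<le> k"
      unfolding k_def by linarith+
    have "in_range (2 * k) n1" "in_range (2 * k) (n1 + 1)" "in_range (2 * k) n2"
      using k by (simp_all only: in_range_iff)
    then have "(config_at k (n1, n2), config_at k (n1 + 1, n2)) \<in> east_D \<union> east_E"
      using east.drive_signed_word_succ[OF _ _ no_11_after_signed_word length_signed_word]
      by (simp only: config_at_def fst_conv snd_conv)
    then have "(config (n1, n2), config (n1 + 1, n2)) \<in> east_D \<union> east_E"
      using k by (simp only: config_eq[of _ k])
    from bspec[OF east_match this] show ?thesis by simp
  qed
  moreover have "north (tiles_Z ! config (n1, n2)) = south (tiles_Z ! config (n1, n2 + 1))" for n1 n2
  proof -
    define k where "k = max (half_length n1) (max (half_length n2) (half_length (n2 + 1)))"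
    have k: "half_length n1 \<le> k" "half_length n2 \<le> k" "half_length (n2 + 1) \<le> k"
      unfolding k_def by linarith+
    have "in_range (2 * k) n2" "in_range (2 * k) (n2 + 1)" "in_range (2 * k) n1"
      using k by (simp_all only: in_range_iff)
    then have "(config_at k (n1, n2), config_at k (n1, n2 + 1)) \<in> north_D \<union> north_E"
      using north.drive_signed_word_succ[OF _ _ no_11_after_signed_word length_signed_word]
      by (simp only: config_at_def fst_conv snd_conv drive_swap[of tile_step])
    then have "(config (n1, n2), config (n1, n2 + 1)) \<in> north_D \<union> north_E"
      using k by (simp only: config_eq[of _ k])
    from bspec[OF north_match this] show ?thesis by simp
  qed
  moreover have "config n < length tiles_Z" for n
    using config_less[of "fst n" "snd n"] by (simp add: tiles_Z_def)
  ultimately show ?thesis unfolding wang_shift_def by blast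
qed

text \<open>Taking the output modulo 16 only affects the initial state, which gets a legal output
  but is never reached by a nonempty word.\<close>

definition tile_dfao :: "(nat, nat \<times> nat, nat) dfao" where
  "tile_dfao = \<lparr>states = {..<17}, alphabet = {0, 1} \<times> {0, 1},
     trans = (\<lambda>q (a, b). if q < 17 \<and> a \<in> {0, 1} \<and> b \<in> {0, 1} then Some (tile_step q a b) else None),
     start = 16, out = (\<lambda>q. q mod 16)\<rparr>"

lemma is_dfao_tile_dfao: "is_dfao tile_dfao"
proof -
  have "tile_step q a b < 17" if "q < 17" "a \<in> {0, 1}" "b \<in> {0, 1}" for q a b
    using tile_step_less[OF that] by simp
  then show ?thesis by (auto simp: is_dfao_def tile_dfao_def split: if_splits)
qed

lemma run_tile_dfao:
  "q < 17 \<Longrightarrow> no_11_after a u \<Longrightarrow> no_11_after b w \<Longrightarrow> length u = length w \<Longrightarrow>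
    run tile_dfao q (zip u w) = Some (drive tile_step q u w)"
proof (induction u w arbitrary: q a b rule: list_induct2')
  case (4 c u d w)
  have "tile_step q c d < 17" using "4.prems" tile_step_less[of q c d] by simp
  then have "run tile_dfao (tile_step q c d) (zip u w) = Some (drive tile_step (tile_step q c d) u w)"
    using 4 by auto
  then show ?case using 4 by (auto simp: tile_dfao_def)
qed auto

lemma dfao_output_rep_F2: "dfao_output tile_dfao (rep_F2 n) = Some (config n)"
proof -
  let ?k = "max (half_length (fst n)) (half_length (snd n))"
  have "no_11_after 0 (signed_word (2 * ?k) (fst n))" "no_11_after 0 (signed_word (2 * ?k) (snd n))"
    by (rule no_11_after_signed_word, simp add: in_range_iff)+
  then have "run tile_dfao 16 (rep_F2 n) = Some (config n)"
    using run_tile_dfao[of 16 0 _ 0] rep_F2_eq[of "fst n" "snd n"]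
    by (simp add: Let_def config_def config_at_def)
  then show ?thesis
    using config_less[of "fst n" "snd n"] by (simp add: dfao_output_def tile_dfao_def)
qed

theorem theorem1:
  shows "\<exists>x \<in> wang_shift tiles_Z. \<exists>M :: (nat, nat \<times> nat, nat) dfao.
    is_dfao M \<and> alphabet M = {(0, 0), (0, 1), (1, 0), (1, 1)} \<and>
    out M ` states M \<subseteq> {0..15} \<and>
    (\<forall>n :: int \<times> int. dfao_output M (rep_F2 n) = Some (x n))"
proof (intro bexI exI conjI allI)
  show "out tile_dfao ` states tile_dfao \<subseteq> {0..15}"
    by (auto simp: tile_dfao_def)
qed (auto simp: tile_dfao_def[THEN arg_cong[where f = alphabet]] is_dfao_tile_dfao dfao_output_rep_F2
    config_in_wang_shift)

end
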